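(* In the downlink NOMA model of the context with imperfect SIC ($\varpi=1$), and with $a_m>\varepsilon_m a_n$, for the special case with $K=1$ the asymptotic connection outage probability (COP) of the $n$-th user with ipSIC at high SNR for the existing formulation (EXF) in PD-NOMA networks is given by $$P_{n1,PD}^{ipSIC,\infty}\approx\frac{\phi_n}{\Omega_I}\sum_{p=0}^{M-n}\binom{M-n}{p}\frac{(-1)^p}{n+p}\int_0^\infty e^{-\frac{y}{\Omega_I}}\left[\sum_{u=1}^U b_u\left(1-e^{-\frac{y\vartheta c_u}{\eta}}\right)\right]^{n+p}dy,$$ where $\vartheta=\frac{\varpi\varepsilon_n}{a_n}$.
   Context: Downlink NOMA in a single cell: a base station (BS) at the centre of a disc of radius $R_D$ serves $M$ users whose locations form a homogeneous binomial point process in the disc (independent, uniformly distributed points). The data streams are mapped onto $K$ subcarriers by a sparse spreading matrix $\mathbf G$ of size $K\times M$, $M>K$, with few non-zero entries; its column for user $\varphi$ is $\mathbf g_\varphi=[g_{\varphi1},\dots,g_{\varphi K}]^T$, where $g_{\varphi k}=1$ or $0$ according to whether the signal is mapped onto subcarrier $k$ or not. The case $K\ne1$ is called CD-NOMA and $K=1$ (data streams of multiple users mapped into one subcarrier) PD-NOMA. The channel vector of user $\varphi$ is $\mathbf h_\varphi=[\tilde h_{\varphi1},\dots,\tilde h_{\varphi K}]^T$ with $\tilde h_{\varphi k}=\sqrt{\eta}\,h_{\varphi k}/\sqrt{1+d^\alpha}$, where $h_{\varphi k}\sim\mathcal{CN}(0,1)$ are independent (Rayleigh fading), $d$ is the distance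 from the BS to the user, $\eta>0$ is the frequency dependent factor and $\alpha>0$ the path loss exponent. Users are ordered so that $\|\mathbf h_M\|_2^2>\dots>\|\mathbf h_n\|_2^2>\dots>\|\mathbf h_m\|_2^2>\dots>\|\mathbf h_1\|_2^2$. Users $m$ and $n$ ($m<n$) are paired, with fixed power allocation coefficients $a_m>a_n$, $a_m+a_n=1$; $\mathbf g_m$ and $\mathbf g_n$ are assumed to have the same column weights. $\rho$ is the transmit SNR. The residual interference channel vector is $\mathbf h_I=[h_{I1},\dots,h_{IK}]^T$ with independent $h_{Ik}\sim\mathcal{CN}(0,\Omega_I)$, independent of the other channels. The SINR of user $n$ detecting user $m$'s signal, and of user $n$ decoding its own signal after successive interference cancellation (SIC), are $$\gamma_{n\to m}=\frac{\rho\,\|\mathrm{diag}(\mathbf h_n)\mathbf g_m\|_2^2\,a_m}{\rho\,\|\mathrm{diag}(\mathbf h_n)\mathbf g_n\|_2^2\,a_n+1},\qquad \gamma_n=\frac{\rho\,\|\mathrm{diag}(\mathbf h_n)\mathbf g_n\|_2^2\,a_n}{\varpi\rho\,\|\mathbf h_I\|_2^2+1},$$ with $\varpi=1$ for imperfect SIC (ipSIC) and $\varpi=0$ for perfect SIC. $\varepsilon_m=2^{R_m}-1$ and $\varepsilon_n=2^{R_n}-1$, where $R_m,R_n$ are the target rates of users $m$ and $n$. The COP of user $n$ for EXF is $\Pr\{\gamma_{n\to m}\le\varepsilon_m\}+\Pr\{\gamma_{n\to m}>\varepsilon_m,\gamma_n\le\varepsilon_n\}$; the superscript $\infty$ denotes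 its asymptotic form at high SNR. Notation: $\phi_n=\frac{M!}{(M-n)!(n-1)!}$, $\theta_u=\cos\left(\frac{2u-1}{2U}\pi\right)$, $b_u=\frac{\pi}{2U}\sqrt{1-\theta_u^2}\,(\theta_u+1)$, $c_u=1+\left(\frac{R_D}{2}(\theta_u+1)\right)^\alpha$. The sign $\approx$ denotes an approximation (Gauss–Chebyshev quadrature with $U$ terms); $U$ is a parameter ensuring a complexity–accuracy tradeoff. *)

theory Defs
  imports "HOL-Probability.Probability"
begin

text \<open>Density of the circularly symmetric complex Gaussian law \<open>CN(0, v)\<close> with respect to Lebesgue
  measure on the complex plane; \<open>v\<close> is the total variance (the mean of \<open>\<bar>Z\<bar>\<^sup>2\<close>), so each of the real
  and imaginary parts has variance \<open>v / 2\<close>.\<close>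

definition CN_density :: "real \<Rightarrow> complex \<Rightarrow> real" where
  "CN_density v z = exp (- (cmod z)\<^sup>2 / v) / (pi * v)"

datatype 'k source = Location nat | Fading nat 'k | Residual 'k

text \<open>Subcarriers are indexed by the finite type \<open>'k\<close>, so that \<open>K = CARD('k)\<close>.  Before ordering, the
  users are \<open>1, \<dots>, M\<close>; user \<open>i\<close> has location \<open>X i\<close> (the base station is at the origin) and
  fading vector \<open>h i\<close>.  The vector \<open>hI\<close> is the residual interference channel.
  The columns \<open>g \<phi>\<close> of the spreading matrix, and \<open>m\<close>, \<open>n\<close>, refer to the users after they have been
  ordered by channel gain.\<close>

locale downlink_noma = prob_space Pr
  for Pr :: "'w measure" +
  fixes M :: nat
    and R\<^sub>D \<eta> \<alpha> \<Omega>\<^sub>I :: real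
    and X :: "nat \<Rightarrow> 'w \<Rightarrow> complex"
    and h :: "nat \<Rightarrow> 'w \<Rightarrow> complex ^ 'k::finite"
    and hI :: "'w \<Rightarrow> complex ^ 'k"
    and g :: "nat \<Rightarrow> complex ^ 'k"
    and m n :: nat
    and a\<^sub>m a\<^sub>n R\<^sub>m R\<^sub>n :: real
  assumes more_users: "CARD('k) < M"
    and params_pos: "0 < R\<^sub>D" "0 < \<eta>" "0 < \<alpha>" "0 < \<Omega>\<^sub>I"
    and locations: "\<And>i. i \<in> {1..M} \<Longrightarrow> distr Pr borel (X i) = uniform_measure lborel (cball 0 R\<^sub>D)"
    and fading: "\<And>i k. i \<in> {1..M} \<Longrightarrow>
          distributed Pr lborel (\<lambda>\<omega>. h i \<omega> $ k) (\<lambda>z. ennreal (CN_density 1 z))"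
    and residual: "\<And>k. distributed Pr lborel (\<lambda>\<omega>. hI \<omega> $ k) (\<lambda>z. ennreal (CN_density \<Omega>\<^sub>I z))"
    and independent: "indep_vars (\<lambda>_. borel)
          (\<lambda>s \<omega>. case s of Location i \<Rightarrow> X i \<omega> | Fading i k \<Rightarrow> h i \<omega> $ k | Residual k \<Rightarrow> hI \<omega> $ k)
          (Location ` {1..M} \<union> {Fading i k | i k. i \<in> {1..M}} \<union> range Residual)"
    and spreading_entries: "\<And>\<phi> k. \<phi> \<in> {1..M} \<Longrightarrow> g \<phi> $ k \<in> {0, 1}"
    and spreading_mapped: "\<And>\<phi>. \<phi> \<in> {1..M} \<Longrightarrow> \<exists>k. g \<phi> $ k = 1"
    and same_weight: "card {k. g m $ k = 1} = card {k. g n $ k = 1}"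
    and pairing: "1 \<le> m" "m < n" "n \<le> M"
    and power: "0 < a\<^sub>n" "a\<^sub>n < a\<^sub>m" "a\<^sub>m + a\<^sub>n = 1"
    and rates: "0 < R\<^sub>m" "0 < R\<^sub>n"

definition channel :: "real \<Rightarrow> real \<Rightarrow> complex \<Rightarrow> complex ^ 'k::finite \<Rightarrow> complex ^ 'k" where
  "channel \<eta> \<alpha> x v = (\<chi> k. of_real (sqrt \<eta>) * v $ k / of_real (sqrt (1 + cmod x powr \<alpha>)))"

text \<open>The channel vector of the \<open>\<phi>\<close>-th weakest of the users \<open>1, \<dots>, M\<close>.  In the model
  the gains are almost surely pairwise distinct, so how ties are resolved is irrelevant.\<close>

definition ordered_channel :: "nat \<Rightarrow> (nat \<Rightarrow> complex ^ 'k::finite) \<Rightarrow> nat \<Rightarrow> complex ^ 'k" where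
  "ordered_channel M H \<phi> = H (sort_key (\<lambda>i. (norm (H i))\<^sup>2) [1..<M+1] ! (\<phi> - 1))"

definition diag :: "complex ^ 'k::finite \<Rightarrow> complex ^ 'k ^ 'k" where
  "diag v = (\<chi> i j. if i = j then v $ i else 0)"

text \<open>SINR for detecting the signal of the weaker user \<open>m\<close> at user \<open>n\<close>; \<open>v\<close> is the channel vector
  of user \<open>n\<close>.\<close>

definition sinr_cross ::
  "real \<Rightarrow> real \<Rightarrow> real \<Rightarrow> complex ^ 'k::finite \<Rightarrow> complex ^ 'k \<Rightarrow> complex ^ 'k \<Rightarrow> real" where
  "sinr_cross \<rho> a\<^sub>m a\<^sub>n v g\<^sub>m g\<^sub>n =
     \<rho> * (norm (diag v *v g\<^sub>m))\<^sup>2 * a\<^sub>m / (\<rho> * (norm (diag v *v g\<^sub>n))\<^sup>2 * a\<^sub>n + 1)"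

text \<open>SINR of user \<open>n\<close> for its own signal after interference cancellation; \<open>\<kappa> = 1\<close> for imperfect and
  \<open>\<kappa> = 0\<close> for perfect cancellation.\<close>

definition sinr_own ::
  "real \<Rightarrow> real \<Rightarrow> real \<Rightarrow> complex ^ 'k::finite \<Rightarrow> complex ^ 'k \<Rightarrow> complex ^ 'k \<Rightarrow> real" where
  "sinr_own \<kappa> \<rho> a\<^sub>n v g\<^sub>n v\<^sub>I =
     \<rho> * (norm (diag v *v g\<^sub>n))\<^sup>2 * a\<^sub>n / (\<kappa> * \<rho> * (norm v\<^sub>I)\<^sup>2 + 1)"

definition cop_exf ::
  "'w measure \<Rightarrow> ('w \<Rightarrow> real) \<Rightarrow> ('w \<Rightarrow> real) \<Rightarrow> real \<Rightarrow> real \<Rightarrow> real" where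
  "cop_exf Pr \<gamma>\<^sub>n\<^sub>m \<gamma>\<^sub>n \<epsilon>\<^sub>m \<epsilon>\<^sub>n =
     measure Pr {\<omega> \<in> space Pr. \<gamma>\<^sub>n\<^sub>m \<omega> \<le> \<epsilon>\<^sub>m} +
     measure Pr {\<omega> \<in> space Pr. \<gamma>\<^sub>n\<^sub>m \<omega> > \<epsilon>\<^sub>m \<and> \<gamma>\<^sub>n \<omega> \<le> \<epsilon>\<^sub>n}"

definition order_coeff :: "nat \<Rightarrow> nat \<Rightarrow> real" where
  "order_coeff M n = fact M / (fact (M - n) * fact (n - 1))"

text \<open>\<open>U\<close>-term Gauss--Chebyshev rule for averaging over the distance \<open>r = R\<^sub>D (t + 1) / 2\<close> of a uniform
  point of the disc, whose law in \<open>t\<close> has density \<open>(t + 1) / 2\<close> on \<open>[-1, 1]\<close>; \<open>quad_c\<close> is the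
  path loss \<open>1 + r powr \<alpha>\<close> at the nodes.\<close>

definition cheb_node :: "nat \<Rightarrow> nat \<Rightarrow> real" where
  "cheb_node U u = cos ((2 * real u - 1) / (2 * real U) * pi)"

definition quad_b :: "nat \<Rightarrow> nat \<Rightarrow> real" where
  "quad_b U u = pi / (2 * real U) * sqrt (1 - (cheb_node U u)\<^sup>2) * (cheb_node U u + 1)"

definition quad_c :: "real \<Rightarrow> real \<Rightarrow> nat \<Rightarrow> nat \<Rightarrow> real" where
  "quad_c R\<^sub>D \<alpha> U u = 1 + (R\<^sub>D / 2 * (cheb_node U u + 1)) powr \<alpha>"

end

theory Submission
  imports Defs
begin

text \<open>On a single subcarrier both SINR events concern the ordered gain \<open>W\<close> only: the outage event is
  \<open>W \<le> max (\<delta> / \<rho>) (\<theta> (Y + 1 / \<rho>))\<close> with \<open>Y\<close> the residual interference power and \<open>\<delta>\<close> a constant.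
  These events decrease to \<open>W \<le> \<theta> Y\<close> as \<open>\<rho> \<rightarrow> \<infinity>\<close>.  Conditioning on the exponential variable \<open>Y\<close>, which
  is independent of \<open>W\<close>, turns the limit into an integral of the distribution function of the order
  statistic \<open>W\<close>, a polynomial in the distribution function \<open>F\<close> of an unordered gain.  With
  \<open>t = cos x\<close> the integral over the disc giving \<open>F\<close> becomes one over \<open>[0, \<pi>]\<close>, and the
  Gauss--Chebyshev rule becomes the midpoint rule, so the quadrature values converge to \<open>F\<close>
  pointwise; they are bounded by \<open>\<pi>\<close>, and dominated convergence finishes the proof.\<close>

section \<open>Order statistics and binomial tails\<close>

text \<open>In a sorted list the entries that are at most \<open>w\<close> form an initial segment,
  so position \<open>j\<close> belongs to it exactly when the segment is longer than
  \<open>j\<close>.\<close>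

lemma sorted_nth_le_iff:
  assumes "sorted xs" "j < length xs"
  shows "xs ! j \<le> w \<longleftrightarrow> j < length (filter (\<lambda>x. x \<le> w) xs)"
  using assms
proof (induction xs arbitrary: j)
  case (Cons x xs)
  show ?case
  proof (cases "x \<le> w")
    case True
    then show ?thesis using Cons by (cases j) auto
  next
    case False
    then have "filter (\<lambda>x. x \<le> w) (x # xs) = []"
      using Cons.prems(1) by (auto simp: filter_empty_conv)
    moreover have "x \<le> (x # xs) ! j"
      using Cons.prems by (cases j) auto
    ultimately show ?thesis using False by (metis le_less_trans length_0_conv not_le not_less0 less_le_trans)
  qed
qed simp

text \<open>Sorting only permutes the indices and so preserves the number of keys below a level.
  This removes the sorting, and with it the treatment of ties, from every later event about the
  ordered gain. The shift \<open>n - 1\<close> comes from list positions starting at 0.\<close>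

lemma sort_key_nth_le_iff:
  fixes f :: "nat \<Rightarrow> 'a::linorder"
  assumes "1 \<le> n" "n \<le> M"
  shows "f (sort_key f [1..<M+1] ! (n - 1)) \<le> w \<longleftrightarrow> n \<le> card {i \<in> {1..M}. f i \<le> w}"
proof -
  let ?xs = "sort_key f [1..<M+1]"
  have "mset (filter (\<lambda>i. f i \<le> w) ?xs) = mset (filter (\<lambda>i. f i \<le> w) [1..<M+1])"
    by (simp only: mset_filter mset_sort)
  then have "length (filter (\<lambda>x. x \<le> w) (map f ?xs)) = length (filter (\<lambda>i. f i \<le> w) [1..<M+1])"
    by (simp only: filter_map o_def length_map) (rule mset_eq_length)
  also have "\<dots> = card {i \<in> {1..M}. f i \<le> w}"
    by (subst distinct_card[symmetric]) (auto intro!: arg_cong[where f = card] simp del: upt_Suc)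
  finally have count: "length (filter (\<lambda>x. x \<le> w) (map f ?xs)) = card {i \<in> {1..M}. f i \<le> w}" .
  have "f (?xs ! (n - 1)) = map f ?xs ! (n - 1)"
    using assms by (simp del: upt_Suc)
  also have "\<dots> \<le> w \<longleftrightarrow> n - 1 < length (filter (\<lambda>x. x \<le> w) (map f ?xs))"
    using assms by (intro sorted_nth_le_iff) (auto simp del: upt_Suc)
  finally show ?thesis using assms unfolding count by auto
qed

lemma binomial_times_order: "1 \<le> n \<Longrightarrow> n \<le> M \<Longrightarrow> real (M choose n) * real n = order_coeff M n"
  by (simp add: order_coeff_def binomial_fact fact_reduce[of n])

lemma binomial_times_complement:
  "n < M \<Longrightarrow> real (M choose n) * real (M - n) = order_coeff M (Suc n)"
  by (simp add: order_coeff_def binomial_fact fact_reduce[of "M - n"] del: of_nat_diff)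

text \<open>The termwise derivatives telescope. Descending from \<open>M\<close>, the new term
  \<open>j = n\<close> contributes two pieces by the product rule; by
  \<open>binomial_times_complement\<close> the negative one cancels the derivative of the tail that
  starts at \<open>Suc n\<close>.\<close>

lemma binomial_tail_deriv:
  fixes x :: real
  assumes "1 \<le> n" "n \<le> M"
  shows "((\<lambda>x. \<Sum>j=n..M. real (M choose j) * x ^ j * (1 - x) ^ (M - j))
           has_real_derivative order_coeff M n * x ^ (n - 1) * (1 - x) ^ (M - n)) (at x)"
  using assms(2,1)
proof (induction n rule: inc_induct)
  case base
  then have "order_coeff M M = real M"
    using binomial_times_order[of M M] by simp
  then show ?case by (auto intro!: derivative_eq_intros)
next
  case (step n)
  obtain d where d: "M - n = Suc d" using step.hyps by (cases "M - n") auto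
  then have d': "M - Suc n = d" by simp
  have co: "order_coeff M (Suc n) = real (M choose n) * real (Suc d)"
    "order_coeff M n = real (M choose n) * real n"
    using binomial_times_complement[of n M] binomial_times_order[of n M] step d by auto
  have "{n..M} = insert n {Suc n..M}" using step.hyps by auto
  then have split: "(\<Sum>j=n..M. real (M choose j) * x ^ j * (1 - x) ^ (M - j)) =
     real (M choose n) * x ^ n * (1 - x) ^ Suc d +
     (\<Sum>j=Suc n..M. real (M choose j) * x ^ j * (1 - x) ^ (M - j))" for x :: real
    by (simp add: d)
  have IH: "((\<lambda>x. \<Sum>j=Suc n..M. real (M choose j) * x ^ j * (1 - x) ^ (M - j))
           has_real_derivative order_coeff M (Suc n) * x ^ n * (1 - x) ^ d) (at x)"
    using step.IH step.prems by (simp add: d')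
  show ?case unfolding split d
    by (rule derivative_eq_intros IH refl | simp)+ (simp add: co algebra_simps)
qed

text \<open>Both sides are polynomials that vanish at 0, since every exponent of \<open>x\<close> is
  at least \<open>n \<ge> 1\<close>, and they have the same derivative: on the right the alternating
  sum is the binomial expansion of \<open>(1 - x) ^ (M - n)\<close>.\<close>

lemma binomial_tail_eq:
  fixes x :: real
  assumes n: "1 \<le> n" "n \<le> M"
  shows "(\<Sum>j=n..M. real (M choose j) * x ^ j * (1 - x) ^ (M - j)) =
    order_coeff M n * (\<Sum>p=0..M - n. real ((M - n) choose p) * ((- 1) ^ p / real (n + p)) * x ^ (n + p))"
    (is "?L x = ?R x")
proof -
  have pw: "x ^ (n + p - 1) = x ^ (n - 1) * x ^ p" for x :: real and p
    using n by (simp flip: power_add)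
  have "(?R has_real_derivative order_coeff M n *
      (\<Sum>p=0..M - n. real ((M - n) choose p) * (- 1) ^ p * x ^ (n + p - 1))) (at x)" for x
    using n by (auto intro!: derivative_eq_intros sum.cong simp: mult_ac simp del: of_nat_add)
  moreover have "(\<Sum>p=0..M - n. real ((M - n) choose p) * (- 1) ^ p * x ^ (n + p - 1)) =
      x ^ (n - 1) * (1 - x) ^ (M - n)" for x :: real
    unfolding pw using binomial_ring[of "- x" 1 "M - n"]
    by (simp add: sum_distrib_left atLeast0AtMost power_minus[of x] mult_ac)
  ultimately have R: "(?R has_real_derivative order_coeff M n * x ^ (n - 1) * (1 - x) ^ (M - n)) (at x)" for x
    by (simp add: mult.assoc)
  have "((\<lambda>x. ?L x - ?R x) has_real_derivative 0) (at x)" for x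
    using DERIV_diff[OF binomial_tail_deriv[OF n] R] by simp
  then have "?L x - ?R x = ?L 0 - ?R 0"
    by (intro DERIV_isconst_all) auto
  also have "?L 0 = 0" using n by (intro sum.neutral) auto
  also have "?R 0 = 0" using n by (simp add: power_0_left)
  finally show ?thesis by simp
qed

section \<open>Radial laws in the complex plane\<close>

text \<open>A disc of squared radius \<open>a\<close> has area \<open>pi * a\<close>, linear in
  \<open>a\<close>, so the squared modulus has constant density on the half-line. Values on the
  half-lines \<open>{..a}\<close> determine the measure, as these sets generate the Borel sets and
  are closed under intersection.\<close>

lemma distr_lborel_norm_sq:
  "distr (lborel :: complex measure) borel (\<lambda>z. (cmod z)\<^sup>2) =
    density lborel (\<lambda>s. ennreal (pi * indicator {0..} s))"
    (is "?D = ?E")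
proof (rule measure_eqI_generator_eq[where E = "range atMost" and \<Omega> = UNIV and A = "\<lambda>i. {..real i}"])
  have D: "emeasure ?D {..a} = ennreal (pi * max 0 a)" for a :: real
  proof -
    have "emeasure ?D {..a} = emeasure lborel {z :: complex. (cmod z)\<^sup>2 \<le> a}"
      by (subst emeasure_distr) (auto intro!: arg_cong[where f = "emeasure lborel"])
    also have "\<dots> = ennreal (pi * max 0 a)"
    proof (cases "0 \<le> a")
      case True
      then have "{z :: complex. (cmod z)\<^sup>2 \<le> a} = cball 0 (sqrt a)"
        by (auto simp: real_le_rsqrt power2_eq_square dest: real_le_rsqrt) (metis norm_ge_zero power2_eq_square power_mono real_sqrt_pow2)
      with True show ?thesis by (simp add: emeasure_cball unit_ball_vol_2)
    next
      case False
      then have "{z :: complex. (cmod z)\<^sup>2 \<le> a} = {}"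
        by (auto simp: not_le intro: less_le_trans)
      with False show ?thesis by simp
    qed
    finally show ?thesis .
  qed
  have E: "emeasure ?E {..a} = ennreal (pi * max 0 a)" for a :: real
  proof -
    have "emeasure ?E {..a} = (\<integral>\<^sup>+s. ennreal pi * indicator {0..a} s \<partial>lborel)"
      by (subst emeasure_density) (auto intro!: nn_integral_cong split: split_indicator)
    also have "\<dots> = ennreal (pi * max 0 a)"
      by (auto simp: nn_integral_cmult emeasure_lborel_Icc_eq ennreal_mult max_def)
    finally show ?thesis .
  qed
  show "emeasure ?D A = emeasure ?E A" if "A \<in> range atMost" for A
    using that D E by auto
  show "emeasure ?D {..real i} \<noteq> \<infinity>" for i
    by (simp add: D)
  show "Int_stable (range (atMost :: real \<Rightarrow> real set))"
    by (auto simp: Int_stable_def)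
  show "(\<Union>i. {..real i}) = UNIV"
    by (auto intro: real_arch_simple)
qed (auto simp: borel_eq_atMost)

lemma distr_density_norm_sq:
  assumes [measurable]: "f \<in> borel_measurable borel"
  shows "distr (density lborel (\<lambda>z. f ((cmod z)\<^sup>2))) borel (\<lambda>z. (cmod z)\<^sup>2) =
    density lborel (\<lambda>s. ennreal (pi * indicator {0..} s) * f s)"
  using density_distr[of f borel "\<lambda>z. (cmod z)\<^sup>2" lborel]
  by (simp add: distr_lborel_norm_sq density_density_eq)

text \<open>The Gaussian density depends on \<open>z\<close> only through its squared modulus. The
  factor \<open>pi\<close> of the area law cancels the \<open>pi\<close> of the normalisation, which
  leaves the exponential law of mean \<open>v\<close>.\<close>

lemma (in prob_space) complex_gaussian_norm_sq:
  assumes Z: "distributed M lborel Z (\<lambda>z. ennreal (CN_density v z))" and v: "0 < v"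
  shows "distributed M lborel (\<lambda>\<omega>. (cmod (Z \<omega>))\<^sup>2) (\<lambda>s. ennreal (exponential_density (1 / v) s))"
proof -
  have [measurable]: "Z \<in> borel_measurable M"
    using distributed_measurable[OF Z] by simp
  have "distr M borel (\<lambda>\<omega>. (cmod (Z \<omega>))\<^sup>2) = distr (distr M lborel Z) borel (\<lambda>z. (cmod z)\<^sup>2)"
    by (subst distr_distr) (auto simp: o_def)
  also have "distr M lborel Z = density lborel (\<lambda>z. ennreal (CN_density v z))"
    using Z by (rule distributed_distr_eq_density)
  also have "distr \<dots> borel (\<lambda>z. (cmod z)\<^sup>2) =
      density lborel (\<lambda>s. ennreal (pi * indicator {0..} s) * ennreal (exp (- s / v) / (pi * v)))"
    unfolding CN_density_def by (subst distr_density_norm_sq) auto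
  also have "\<dots> = density lborel (\<lambda>s. ennreal (exponential_density (1 / v) s))"
    using v by (intro density_cong)
      (auto simp: exponential_density_def ennreal_mult[symmetric] split: split_indicator)
  finally have "distr M lborel (\<lambda>\<omega>. (cmod (Z \<omega>))\<^sup>2) = \<dots>"
    by (subst distr_cong[OF refl sets_lborel refl])
  then show ?thesis
    by (simp add: distributed_def)
qed

text \<open>The squared distance of a uniform point of the disc is uniform on
  \<open>{0..R\<^sup>2}\<close>: the \<open>pi\<close> of the area law cancels against the area of
  the disc.\<close>

lemma (in prob_space) nn_integral_uniform_disc:
  fixes f :: "real \<Rightarrow> real"
  assumes X: "distr M borel X = uniform_measure lborel (cball (0 :: complex) R)"
    and R: "0 < R"
    and [measurable]: "X \<in> borel_measurable M" "f \<in> borel_measurable borel"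
    and f: "\<And>s. 0 \<le> s \<Longrightarrow> 0 \<le> f s"
  shows "(\<integral>\<^sup>+\<omega>. ennreal (f ((cmod (X \<omega>))\<^sup>2)) \<partial>M) =
    (\<integral>\<^sup>+s. ennreal (f s) * indicator {0..R\<^sup>2} s \<partial>lborel) / ennreal (R\<^sup>2)"
proof -
  have "(\<integral>\<^sup>+\<omega>. ennreal (f ((cmod (X \<omega>))\<^sup>2)) \<partial>M) =
      (\<integral>\<^sup>+x. ennreal (f ((cmod x)\<^sup>2)) \<partial>uniform_measure lborel (cball 0 R))"
    unfolding X[symmetric] by (subst nn_integral_distr) auto
  also have "\<dots> = (\<integral>\<^sup>+x. ennreal (f ((cmod x)\<^sup>2)) * indicator (cball 0 R) x \<partial>lborel) /
      emeasure lborel (cball (0 :: complex) R)"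
    by (rule nn_integral_uniform_measure) auto
  also have "emeasure lborel (cball (0 :: complex) R) = ennreal pi * ennreal (R\<^sup>2)"
    using R by (simp add: emeasure_cball unit_ball_vol_2 ennreal_mult)
  also have "(\<integral>\<^sup>+x. ennreal (f ((cmod x)\<^sup>2)) * indicator (cball 0 R) x \<partial>lborel) =
      (\<integral>\<^sup>+x. ennreal (f ((cmod x)\<^sup>2)) * indicator {0..R\<^sup>2} ((cmod x)\<^sup>2) \<partial>lborel)"
    using R by (intro nn_integral_cong)
      (auto split: split_indicator simp: abs_le_square_iff[symmetric])
  also have "\<dots> = (\<integral>\<^sup>+s. ennreal (f s) * indicator {0..R\<^sup>2} s
      \<partial>distr (lborel :: complex measure) borel (\<lambda>z. (cmod z)\<^sup>2))"
    by (subst nn_integral_distr) auto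
  also have "\<dots> = (\<integral>\<^sup>+s. ennreal pi * (ennreal (f s) * indicator {0..R\<^sup>2} s) \<partial>lborel)"
    unfolding distr_lborel_norm_sq
    by (subst nn_integral_density) (auto intro!: nn_integral_cong split: split_indicator)
  also have "\<dots> = ennreal pi * (\<integral>\<^sup>+s. ennreal (f s) * indicator {0..R\<^sup>2} s \<partial>lborel)"
    by (rule nn_integral_cmult) auto
  also have "\<dots> / (ennreal pi * ennreal (R\<^sup>2)) =
      (\<integral>\<^sup>+s. ennreal (f s) * indicator {0..R\<^sup>2} s \<partial>lborel) / ennreal (R\<^sup>2)"
    by (subst (1 2) mult.commute, rule divide_mult_eq) auto
  finally show ?thesis .
qed

text \<open>Conditioning on \<open>U\<close> by Tonelli: independence makes the joint law a product,
  and the section of the event over a fixed value of \<open>U\<close> is a half-line. It serves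
  twice, once for fading given the location and once for the ordered gain given the residual
  interference.\<close>

lemma (in prob_space) emeasure_indep_le:
  fixes V :: "'a \<Rightarrow> real"
  assumes indep: "indep_var S U borel V" and f[measurable]: "f \<in> borel_measurable S"
  shows "emeasure M {\<omega> \<in> space M. V \<omega> \<le> f (U \<omega>)} =
    (\<integral>\<^sup>+\<omega>. ennreal (prob {\<omega>' \<in> space M. V \<omega>' \<le> f (U \<omega>)}) \<partial>M)"
proof -
  have [measurable]: "U \<in> measurable M S" "V \<in> borel_measurable M"
    and joint: "distr M S U \<Otimes>\<^sub>M distr M borel V = distr M (S \<Otimes>\<^sub>M borel) (\<lambda>x. (U x, V x))"
    using indep by (auto simp: indep_var_distribution_eq)
  interpret V: prob_space "distr M borel V" by (rule prob_space_distr) simp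
  let ?A = "{p \<in> space (S \<Otimes>\<^sub>M borel). snd p \<le> f (fst p)}"
  have A: "?A \<in> sets (S \<Otimes>\<^sub>M borel)" by measurable
  have "emeasure M {\<omega> \<in> space M. V \<omega> \<le> f (U \<omega>)} =
      emeasure (distr M (S \<Otimes>\<^sub>M borel) (\<lambda>x. (U x, V x))) ?A"
    using A measurable_space[OF \<open>U \<in> measurable M S\<close>]
    by (subst emeasure_distr) (auto intro!: arg_cong[where f = "emeasure M"] simp: space_pair_measure)
  also have "\<dots> = (\<integral>\<^sup>+u. emeasure (distr M borel V) (Pair u -` ?A) \<partial>distr M S U)"
    unfolding joint[symmetric] using A by (intro V.emeasure_pair_measure_alt) simp
  also have "\<dots> = (\<integral>\<^sup>+\<omega>. emeasure (distr M borel V) (Pair (U \<omega>) -` ?A) \<partial>M)"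
    using V.measurable_emeasure_Pair[of ?A S] A by (intro nn_integral_distr) (simp_all cong: measurable_cong_sets)
  also have "\<dots> = (\<integral>\<^sup>+\<omega>. ennreal (prob {\<omega>' \<in> space M. V \<omega>' \<le> f (U \<omega>)}) \<partial>M)"
  proof (rule nn_integral_cong)
    fix \<omega> assume "\<omega> \<in> space M"
    then have "U \<omega> \<in> space S"
      using measurable_space[OF \<open>U \<in> measurable M S\<close>] by blast
    then have "Pair (U \<omega>) -` ?A = {..f (U \<omega>)}"
      by (auto simp: space_pair_measure)
    then show "emeasure (distr M borel V) (Pair (U \<omega>) -` ?A) =
        ennreal (prob {\<omega>' \<in> space M. V \<omega>' \<le> f (U \<omega>)})"
      by (simp add: emeasure_distr vimage_def Int_def conj_commute flip: emeasure_eq_measure)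
  qed
  finally show ?thesis .
qed

text \<open>The integration variable \<open>s\<close> is the squared distance from the base station, which is uniform on
  \<open>[0, R\<^sup>2]\<close>.\<close>

definition disc_gain_cdf :: "real \<Rightarrow> real \<Rightarrow> real \<Rightarrow> real \<Rightarrow> real" where
  "disc_gain_cdf R \<eta> \<alpha> w =
     integral {0..R\<^sup>2} (\<lambda>s. 1 - exp (- w * (1 + sqrt s powr \<alpha>) / \<eta>)) / R\<^sup>2"

lemma disc_gain_integrand_nonneg:
  fixes w :: real
  assumes "0 < \<eta>" "0 \<le> w"
  shows "0 \<le> 1 - exp (- w * (1 + sqrt s powr \<alpha>) / \<eta>)"
proof -
  have "0 \<le> w * (1 + sqrt s powr \<alpha>) / \<eta>" using assms by simp
  then show ?thesis by simp
qed

lemma continuous_on_disc_gain_integrand: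
  fixes w :: real
  assumes "0 < \<eta>" "0 < \<alpha>"
  shows "continuous_on {0..R\<^sup>2} (\<lambda>s. 1 - exp (- w * (1 + sqrt s powr \<alpha>) / \<eta>))"
  using assms by (intro continuous_intros continuous_on_powr') auto

lemma disc_gain_cdf_nonneg:
  assumes "0 < \<eta>" "0 < \<alpha>" "0 \<le> w"
  shows "0 \<le> disc_gain_cdf R \<eta> \<alpha> w"
  unfolding disc_gain_cdf_def using assms
  by (intro divide_nonneg_nonneg integral_nonneg integrable_continuous_real
      continuous_on_disc_gain_integrand disc_gain_integrand_nonneg) auto

text \<open>Given the location, the event says that a unit-mean exponential variable is at most
  \<open>w * (1 + cmod (X \<omega>) powr \<alpha>) / \<eta>\<close>. Averaging the exponential
  distribution function over the uniform squared distance gives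
  \<open>disc_gain_cdf\<close>.\<close>

lemma (in prob_space) faded_gain_cdf:
  assumes X: "distr M borel X = uniform_measure lborel (cball (0 :: complex) R)"
    and Z: "distributed M lborel Z (\<lambda>z. ennreal (CN_density 1 z))"
    and indep: "indep_var borel X borel Z"
    and pos: "0 < R" "0 < \<eta>" "0 < \<alpha>" "0 \<le> w"
  shows "prob {\<omega> \<in> space M. \<eta> * (cmod (Z \<omega>))\<^sup>2 / (1 + cmod (X \<omega>) powr \<alpha>) \<le> w} =
    disc_gain_cdf R \<eta> \<alpha> w"
proof -
  let ?q = "\<lambda>s. 1 - exp (- w * (1 + sqrt s powr \<alpha>) / \<eta>)"
  have [measurable]: "X \<in> borel_measurable M" "Z \<in> borel_measurable M"
    using indep by (auto simp: indep_var_distribution_eq)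
  have q: "0 \<le> ?q s" for s
    using pos disc_gain_integrand_nonneg by blast
  have indep': "indep_var borel (\<lambda>\<omega>. (cmod (X \<omega>))\<^sup>2) borel (\<lambda>\<omega>. (cmod (Z \<omega>))\<^sup>2)"
    using indep_var_compose[OF indep, of "\<lambda>z. (cmod z)\<^sup>2" borel "\<lambda>z. (cmod z)\<^sup>2" borel] by (simp add: o_def)
  have expo: "distributed M lborel (\<lambda>\<omega>. (cmod (Z \<omega>))\<^sup>2) (exponential_density 1)"
    using complex_gaussian_norm_sq[OF Z] by simp
  have "{\<omega> \<in> space M. \<eta> * (cmod (Z \<omega>))\<^sup>2 / (1 + cmod (X \<omega>) powr \<alpha>) \<le> w} =
      {\<omega> \<in> space M. (cmod (Z \<omega>))\<^sup>2 \<le> w * (1 + cmod (X \<omega>) powr \<alpha>) / \<eta>}"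
    using pos by (auto simp: field_simps add_pos_nonneg add_nonneg_eq_0_iff)
  then have "emeasure M {\<omega> \<in> space M. \<eta> * (cmod (Z \<omega>))\<^sup>2 / (1 + cmod (X \<omega>) powr \<alpha>) \<le> w} =
      (\<integral>\<^sup>+\<omega>. ennreal (prob {\<omega>' \<in> space M. (cmod (Z \<omega>'))\<^sup>2 \<le> w * (1 + cmod (X \<omega>) powr \<alpha>) / \<eta>}) \<partial>M)"
    using emeasure_indep_le[OF indep', of "\<lambda>s. w * (1 + sqrt s powr \<alpha>) / \<eta>"] by simp
  also have "\<dots> = (\<integral>\<^sup>+\<omega>. ennreal (?q ((cmod (X \<omega>))\<^sup>2)) \<partial>M)"
    using pos by (subst exponential_distributedD_le[OF expo]) simp_all
  also have "\<dots> = (\<integral>\<^sup>+s. ennreal (?q s) * indicator {0..R\<^sup>2} s \<partial>lborel) / ennreal (R\<^sup>2)"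
    using X pos q by (intro nn_integral_uniform_disc) auto
  also have "(\<integral>\<^sup>+s. ennreal (?q s) * indicator {0..R\<^sup>2} s \<partial>lborel) = ennreal (integral {0..R\<^sup>2} ?q)"
    using q pos
    by (intro nn_integral_has_integral_lebesgue' integrable_integral integrable_continuous_real
        continuous_on_disc_gain_integrand)
  also have "\<dots> / ennreal (R\<^sup>2) = ennreal (disc_gain_cdf R \<eta> \<alpha> w)"
    using pos q unfolding disc_gain_cdf_def
    by (intro divide_ennreal integral_nonneg integrable_continuous_real
        continuous_on_disc_gain_integrand) auto
  finally show ?thesis
    using pos disc_gain_cdf_nonneg by (simp add: measure_def)
qed

section \<open>Gauss--Chebyshev quadrature over the disc\<close>

text \<open>By uniform continuity the integrand on a short cell stays close to its value at the
  midpoint, so the errors of the cells add up to at most the interval length times that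
  closeness.\<close>

lemma midpoint_sum_tendsto:
  fixes f :: "real \<Rightarrow> real"
  assumes b: "0 < b" and cont: "continuous_on {0..b} f"
  shows "(\<lambda>N. \<Sum>u=1..N. b / real N * f ((2 * real u - 1) / (2 * real N) * b)) \<longlonglongrightarrow> integral {0..b} f"
proof (rule LIMSEQ_I)
  fix e :: real assume "0 < e"
  \<comment> \<open>With this tolerance the total error over an interval of length \<open>b\<close>
    is at most \<open>e / 2\<close>, which leaves room for the strict inequality.\<close>
  define e' where "e' = e / (2 * b)"
  have e': "0 < e'" using \<open>0 < e\<close> b by (simp add: e'_def)
  have "uniformly_continuous_on {0..b} f"
    by (rule compact_uniformly_continuous[OF cont]) simp
  then obtain d where d: "0 < d" "\<And>s t. s \<in> {0..b} \<Longrightarrow> t \<in> {0..b} \<Longrightarrow> \<bar>s - t\<bar> < d \<Longrightarrow> \<bar>f s - f t\<bar> < e'"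
    using e' unfolding uniformly_continuous_on_def dist_real_def by (metis (no_types, lifting))
  \<comment> \<open>Beyond \<open>N0\<close> the cell width \<open>b / real N\<close> is below the
    modulus of continuity \<open>d\<close>.\<close>
  obtain N0 :: nat where N0: "b / d < real N0" using reals_Archimedean2 by blast
  have "\<bar>(\<Sum>u=1..N. b / real N * f ((2 * real u - 1) / (2 * real N) * b)) - integral {0..b} f\<bar> < e"
    if "N0 \<le> N" for N
  proof -
    define \<delta> where "\<delta> = b / real N"
    have "b / d < real N" using N0 that by linarith
    then have N: "0 < N" using b d(1) by (metis divide_pos_pos gr0I less_asym of_nat_0)
    have \<delta>: "0 < \<delta>" "\<delta> < d" "real N * \<delta> = b"
      using \<open>b / d < real N\<close> N b d(1) by (auto simp: \<delta>_def field_simps)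
    \<comment> \<open>Induction on the number \<open>k\<close> of cells already covered; each
      further cell adds an error of at most \<open>\<delta> * e'\<close>.\<close>
    have "\<bar>(\<Sum>u=1..k. \<delta> * f ((2 * real u - 1) / 2 * \<delta>)) - integral {0..real k * \<delta>} f\<bar> \<le> real k * \<delta> * e'"
      if "k \<le> N" for k
      using that
    proof (induction k)
      case (Suc k)
      have le: "real (Suc k) * \<delta> \<le> b"
        using Suc.prems \<delta> by (metis mult_right_mono of_nat_le_iff less_imp_le)
      have "integral {0..real k * \<delta>} f + integral {real k * \<delta>..real (Suc k) * \<delta>} f =
          integral {0..real (Suc k) * \<delta>} f"
        using \<delta> le
        by (intro Henstock_Kurzweil_Integration.integral_combine integrable_continuous_real
            continuous_on_subset[OF cont]) (auto simp: mult_right_mono)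
      moreover have "\<bar>\<delta> * f ((2 * real (Suc k) - 1) / 2 * \<delta>) - integral {real k * \<delta>..real (Suc k) * \<delta>} f\<bar>
          \<le> \<delta> * e'"
      proof -
        let ?c = "(2 * real (Suc k) - 1) / 2 * \<delta>"
        have c: "?c \<in> {real k * \<delta>..real (Suc k) * \<delta>}" using \<delta> by (simp add: field_simps)
        have sub: "{real k * \<delta>..real (Suc k) * \<delta>} \<subseteq> {0..b}" using \<delta> le by auto
        have int: "f integrable_on {real k * \<delta>..real (Suc k) * \<delta>}"
          by (rule integrable_continuous_real[OF continuous_on_subset[OF cont sub]])
        have len: "real (Suc k) * \<delta> - real k * \<delta> = \<delta>" by (simp add: algebra_simps)
        have "((\<lambda>t. f ?c - f t) has_integral
            (\<delta> * f ?c - integral {real k * \<delta>..real (Suc k) * \<delta>} f)) {real k * \<delta>..real (Suc k) * \<delta>}"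
          using has_integral_diff[OF has_integral_const_real[of "f ?c" "real k * \<delta>" "real (Suc k) * \<delta>"]
              integrable_integral[OF int]] len \<delta> by simp
        moreover have "norm (f ?c - f t) \<le> e'" if "t \<in> {real k * \<delta>..real (Suc k) * \<delta>}" for t
        proof -
          have "\<bar>?c - t\<bar> \<le> \<delta>" using c that len unfolding atLeastAtMost_iff by linarith
          then have "\<bar>f ?c - f t\<bar> < e'" using subsetD[OF sub c] subsetD[OF sub that] \<delta> by (intro d(2)) auto
          then show ?thesis by simp
        qed
        ultimately show ?thesis
          using has_integral_bound_real[of e' "{}" "\<lambda>t. f ?c - f t" _ "real k * \<delta>" "real (Suc k) * \<delta>"] e' len \<delta>
          by (simp add: mult.commute)
      qed
      ultimately show ?case
        using Suc by (simp add: algebra_simps)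
    qed simp
    from this[of N] have "\<bar>(\<Sum>u=1..N. \<delta> * f ((2 * real u - 1) / 2 * \<delta>)) - integral {0..b} f\<bar> \<le> b * e'"
      by (simp add: \<delta>)
    also have "b * e' < e" using b \<open>0 < e\<close> by (simp add: e'_def)
    finally show ?thesis by (simp add: \<delta>_def)
  qed
  then show "\<exists>N0. \<forall>N\<ge>N0. norm ((\<Sum>u=1..N. b / real N * f ((2 * real u - 1) / (2 * real N) * b)) - integral {0..b} f) < e"
    by auto
qed

lemma cheb_angle: "u \<in> {1..U} \<Longrightarrow> (2 * real u - 1) / (2 * real U) * pi \<in> {0..pi}"
proof -
  assume "u \<in> {1..U}"
  then have "0 \<le> (2 * real u - 1) / (2 * real U)" "(2 * real u - 1) / (2 * real U) \<le> 1" by auto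
  then show ?thesis
    using mult_right_mono[of "(2 * real u - 1) / (2 * real U)" 1 pi]
    by (auto simp del: times_divide_eq_left)
qed

lemma cos_plus_one_nonneg: "0 \<le> cos x + 1" for x :: real
  using cos_ge_minus_one[of x] by linarith

text \<open>The node is the cosine of an angle in \<open>{0..pi}\<close>, where the sine is
  nonnegative, so the square root is that sine. The weight then splits into the cell width
  \<open>pi / real U\<close> of a midpoint rule and a factor of the integrand.\<close>

lemma quad_b_altdef:
  "u \<in> {1..U} \<Longrightarrow> quad_b U u =
    pi / real U * (sin ((2 * real u - 1) / (2 * real U) * pi) * (cos ((2 * real u - 1) / (2 * real U) * pi) + 1) / 2)"
  using cheb_angle[of u U] sin_ge_zero[of "(2 * real u - 1) / (2 * real U) * pi"]
  by (simp add: quad_b_def cheb_node_def flip: sin_squared_eq)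

lemma quad_b_nonneg: "0 \<le> quad_b U u"
  unfolding quad_b_def cheb_node_def
  by (intro mult_nonneg_nonneg real_sqrt_ge_zero cos_plus_one_nonneg) (auto simp: abs_square_le_1)

text \<open>Each weight is at most \<open>pi / real U\<close>, as the sine is at most 1 and the
  cosine plus one at most 2. A bound independent of \<open>U\<close> is what dominated convergence
  will require.\<close>

lemma sum_quad_b_le: "(\<Sum>u=1..U. quad_b U u) \<le> pi"
proof -
  have "quad_b U u \<le> pi / real U" if "u \<in> {1..U}" for u
  proof -
    let ?c = "(2 * real u - 1) / (2 * real U) * pi"
    have "sin ?c * (cos ?c + 1) \<le> 1 * 2"
      using cheb_angle[OF that] cos_plus_one_nonneg[of ?c] cos_le_one[of ?c] sin_le_one[of ?c]
      by (intro mult_mono) (auto simp: sin_ge_zero)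
    then have "pi / real U * (sin ?c * (cos ?c + 1) / 2) \<le> pi / real U * 1"
      by (intro mult_left_mono) auto
    then show ?thesis unfolding quad_b_altdef[OF that] by simp
  qed
  then have "(\<Sum>u=1..U. quad_b U u) \<le> real (card {1..U}) * (pi / real U)"
    by (intro sum_bounded_above) auto
  then show ?thesis by (cases "U = 0") auto
qed

text \<open>The substitution of \<open>(R / 2 * (cos x + 1))\<^sup>2\<close> for the squared
  distance turns the average into an integral over \<open>{0..pi}\<close> of a continuous function,
  whose midpoint sums are exactly the quadrature sums.\<close>

lemma disc_quadrature_tendsto:
  fixes q :: "real \<Rightarrow> real"
  assumes R: "0 < R" and cont: "continuous_on {0..R\<^sup>2} q"
  shows "(\<lambda>U. \<Sum>u=1..U. quad_b U u * q ((R / 2 * (cheb_node U u + 1))\<^sup>2)) \<longlonglongrightarrow>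
    integral {0..R\<^sup>2} q / R\<^sup>2"
proof -
  define s where "s x = (R / 2 * (cos x + 1))\<^sup>2" for x
  define s' where "s' x = - R\<^sup>2 / 2 * (cos x + 1) * sin x" for x
  define f where "f x = sin x * (cos x + 1) / 2 * q (s x)" for x
  have s_le: "s x \<in> {0..R\<^sup>2}" for x
  proof -
    have "R / 2 * (cos x + 1) \<le> R" using R by (simp add: field_simps)
    moreover have "0 \<le> R / 2 * (cos x + 1)"
      using R by (intro mult_nonneg_nonneg cos_plus_one_nonneg) auto
    ultimately show ?thesis by (auto simp: s_def intro: power_mono)
  qed
  have conts: "continuous_on {0..pi} s"
    unfolding s_def by (intro continuous_intros)
  have contf: "continuous_on {0..pi} f"
    unfolding f_def using s_le
    by (intro continuous_intros continuous_on_compose2[OF cont conts]) auto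
  have "((\<lambda>x. s' x *\<^sub>R q (s x)) has_integral
      (integral {s 0..s pi} q - integral {s pi..s 0} q)) {0..pi}"
  proof (rule has_integral_substitution_general[where s = "{}"])
    show "(s has_real_derivative s' x) (at x within {0..pi})" for x
      unfolding s_def s'_def
      by (auto intro!: derivative_eq_intros simp: power2_eq_square field_simps)
  qed (use s_le cont conts in auto)
  then have "((\<lambda>x. - 1 / R\<^sup>2 * (s' x *\<^sub>R q (s x))) has_integral
      - 1 / R\<^sup>2 * (integral {s 0..s pi} q - integral {s pi..s 0} q)) {0..pi}"
    by (rule has_integral_mult_right)
  moreover have "- 1 / R\<^sup>2 * (s' x *\<^sub>R q (s x)) = f x" for x
    using R by (simp add: s'_def f_def field_simps)
  \<comment> \<open>The substitution reverses orientation: \<open>{s 0..s pi}\<close> is empty, so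
    only the subtracted integral survives, and its sign cancels that of the factor
    \<open>- 1 / R\<^sup>2\<close>.\<close>
  moreover have "s 0 = R\<^sup>2" "s pi = 0" by (simp_all add: s_def)
  ultimately have "integral {0..pi} f = integral {0..R\<^sup>2} q / R\<^sup>2"
    using R by (simp add: integral_unique)
  moreover have "(\<Sum>u=1..U. pi / real U * f ((2 * real u - 1) / (2 * real U) * pi)) =
      (\<Sum>u=1..U. quad_b U u * q ((R / 2 * (cheb_node U u + 1))\<^sup>2))" for U
    by (intro sum.cong) (auto simp: quad_b_altdef f_def s_def cheb_node_def)
  ultimately show ?thesis
    using midpoint_sum_tendsto[OF pi_gt_zero contf] by simp
qed

section \<open>Distribution function and measurability of an order statistic\<close>

lemma sum_subsets_by_card:
  fixes c :: "nat \<Rightarrow> real"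
  assumes "finite I"
  shows "(\<Sum>J | J \<subseteq> I \<and> n \<le> card J. c (card J)) = (\<Sum>j=n..card I. real (card I choose j) * c j)"
proof -
  have "(\<Sum>J | J \<subseteq> I \<and> n \<le> card J. c (card J)) =
      (\<Sum>j=n..card I. \<Sum>J | J \<in> {J. J \<subseteq> I \<and> n \<le> card J} \<and> card J = j. c (card J))"
    using assms by (intro sum.group[symmetric]) (auto intro: card_mono)
  also have "\<dots> = (\<Sum>j=n..card I. \<Sum>J | J \<subseteq> I \<and> card J = j. c j)"
    by (intro sum.cong) auto
  also have "\<dots> = (\<Sum>j=n..card I. real (card I choose j) * c j)"
    using assms by (simp add: n_subsets)
  finally show ?thesis .
qed

text \<open>The event is split according to the exact set \<open>J\<close> of indices with value at
  most \<open>w\<close>. Independence gives each piece a probability that depends only on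
  \<open>card J\<close>, so grouping by size yields a binomial tail, which
  \<open>binomial_tail_eq\<close> rewrites.\<close>

lemma (in prob_space) order_statistic_cdf:
  fixes G :: "nat \<Rightarrow> 'a \<Rightarrow> real"
  assumes indep: "indep_vars (\<lambda>_. borel) G {1..N}"
    and F: "\<And>i. i \<in> {1..N} \<Longrightarrow> prob {\<omega> \<in> space M. G i \<omega> \<le> w} = F"
    and n: "1 \<le> n" "n \<le> N"
  shows "prob {\<omega> \<in> space M. n \<le> card {i \<in> {1..N}. G i \<omega> \<le> w}} =
    order_coeff N n * (\<Sum>p=0..N - n. real ((N - n) choose p) * ((- 1) ^ p / real (n + p)) * F ^ (n + p))"
proof -
  let ?I = "{1..N}"
  have [measurable]: "G i \<in> borel_measurable M" if "i \<in> ?I" for i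
    using indep that by (simp add: indep_vars_def)
  \<comment> \<open>Indices outside \<open>J\<close> are forced strictly above \<open>w\<close>, so
    the events \<open>E J\<close> for different subsets \<open>J\<close> of the index set are
    disjoint.\<close>
  define B where "B J i = (if i \<in> J then {..w} else {w<..})" for J and i :: nat
  define E where "E J = (\<Inter>i\<in>?I. G i -` B J i \<inter> space M)" for J
  have ne: "?I \<noteq> {}" using n by auto
  have E_iff: "\<omega> \<in> E J \<longleftrightarrow> \<omega> \<in> space M \<and> {i \<in> ?I. G i \<omega> \<le> w} = J" if "J \<subseteq> ?I" for J \<omega>
  proof -
    have "\<omega> \<in> E J \<longleftrightarrow> \<omega> \<in> space M \<and> (\<forall>i\<in>?I. G i \<omega> \<in> B J i)"
      using ne unfolding E_def by blast
    also have "\<dots> \<longleftrightarrow> \<omega> \<in> space M \<and> (\<forall>i\<in>?I. G i \<omega> \<le> w \<longleftrightarrow> i \<in> J)"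
    proof -
      have "x \<in> B J i \<longleftrightarrow> (x \<le> w \<longleftrightarrow> i \<in> J)" for x i
        by (auto simp: B_def)
      then show ?thesis by simp
    qed
    also have "\<dots> \<longleftrightarrow> \<omega> \<in> space M \<and> {i \<in> ?I. G i \<omega> \<le> w} = J"
      using that by blast
    finally show ?thesis .
  qed
  have E_meas: "E J \<in> events" for J
    unfolding E_def B_def using ne by (intro sets.finite_INT) (auto intro!: measurable_sets[of _ _ borel])
  have E_prob: "prob (E J) = F ^ card J * (1 - F) ^ (N - card J)" if "J \<subseteq> ?I" for J
  proof -
    have "prob (E J) = (\<Prod>i\<in>?I. prob (G i -` B J i \<inter> space M))"
      unfolding E_def using ne by (intro indep_varsD[OF indep]) (auto simp: B_def)
    also have "\<dots> = (\<Prod>i\<in>?I. if i \<in> J then F else 1 - F)"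
    proof (rule prod.cong[OF refl])
      fix i assume i: "i \<in> ?I"
      have le: "G i -` {..w} \<inter> space M = {\<omega> \<in> space M. G i \<omega> \<le> w}" by auto
      have gt: "G i -` {w<..} \<inter> space M = space M - {\<omega> \<in> space M. G i \<omega> \<le> w}" by auto
      show "prob (G i -` B J i \<inter> space M) = (if i \<in> J then F else 1 - F)"
        using i by (simp add: B_def le gt F prob_compl)
    qed
    also have "\<dots> = F ^ card J * (1 - F) ^ card (?I - J)"
      using that by (simp add: prod.If_cases Int_absorb1 Diff_eq[symmetric])
    also have "card (?I - J) = N - card J"
      using that by (simp add: card_Diff_subset finite_subset)
    finally show ?thesis .
  qed
  let ?S = "{J. J \<subseteq> ?I \<and> n \<le> card J}"
  have "{\<omega> \<in> space M. n \<le> card {i \<in> ?I. G i \<omega> \<le> w}} = (\<Union>J\<in>?S. E J)"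
    by (auto simp: E_iff)
  also have "prob \<dots> = (\<Sum>J\<in>?S. prob (E J))"
    using E_meas by (intro finite_measure_finite_Union)
      (auto simp: disjoint_family_on_def E_iff)
  also have "\<dots> = (\<Sum>J\<in>?S. F ^ card J * (1 - F) ^ (N - card J))"
    by (intro sum.cong) (auto simp: E_prob)
  also have "\<dots> = (\<Sum>j=n..N. real (N choose j) * F ^ j * (1 - F) ^ (N - j))"
    using sum_subsets_by_card[of ?I "\<lambda>j. F ^ j * (1 - F) ^ (N - j)" n] by (simp add: mult.assoc)
  finally show ?thesis
    unfolding binomial_tail_eq[OF n] .
qed

text \<open>The selected index itself varies with \<open>x\<close>, so composition does not apply
  directly. The sublevel sets, however, say that a finite sum of measurable indicators reaches
  \<open>n\<close>.\<close>

lemma measurable_order_statistic: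
  fixes f :: "nat \<Rightarrow> 'a \<Rightarrow> real"
  assumes n: "1 \<le> n" "n \<le> N" and f: "\<And>i. i \<in> {1..N} \<Longrightarrow> f i \<in> borel_measurable M"
  shows "(\<lambda>x. f (sort_key (\<lambda>i. f i x) [1..<N+1] ! (n - 1)) x) \<in> borel_measurable M"
proof (rule borel_measurable_iff_le[THEN iffD2], intro allI)
  fix w
  have "real (card {i \<in> {1..N}. f i x \<le> w}) = (\<Sum>i=1..N. if f i x \<le> w then 1 else 0)" for x
    by (simp add: sum.If_cases Int_def)
  moreover have "n \<le> card {i \<in> {1..N}. f i x \<le> w} \<longleftrightarrow> real n \<le> real (card {i \<in> {1..N}. f i x \<le> w})" for x
    by (rule of_nat_le_iff[symmetric])
  ultimately have "{x \<in> space M. f (sort_key (\<lambda>i. f i x) [1..<N+1] ! (n - 1)) x \<le> w} =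
      {x \<in> space M. real n \<le> (\<Sum>i=1..N. if f i x \<le> w then 1 else 0)}"
    unfolding sort_key_nth_le_iff[OF n, of "\<lambda>i. f i _"] by simp
  also have "\<dots> \<in> sets M"
  proof -
    have "(\<lambda>x. \<Sum>i=1..N. if f i x \<le> w then 1 else (0 :: real)) \<in> borel_measurable M"
      by (rule borel_measurable_sum) (use f in measurable)
    then show ?thesis by measurable
  qed
  finally show "{x \<in> space M. f (sort_key (\<lambda>i. f i x) [1..<N+1] ! (n - 1)) x \<le> w} \<in> sets M" .
qed

section \<open>Exponentially weighted integrals and their limit in the number of nodes\<close>

lemma set_integrable_exp_decay:
  assumes "0 < (v :: real)"
  shows "set_integrable lborel {0..} (\<lambda>y. exp (- y / v))"
proof -
  interpret prob_space "density lborel (exponential_density (1 / v))"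
    using assms by (intro prob_space_exponential_density) simp
  have "(\<integral>\<^sup>+y. ennreal (exponential_density (1 / v) y) \<partial>lborel) = 1"
    using emeasure_space_1 by (simp add: emeasure_density)
  then have "integrable lborel (exponential_density (1 / v))"
    using assms by (intro integrableI_nonneg) (auto simp: exponential_density_nonneg)
  \<comment> \<open>The factor \<open>v\<close> cancels the rate \<open>1 / v\<close> in front of
    the exponential density.\<close>
  then have "integrable lborel (\<lambda>y. v * exponential_density (1 / v) y)"
    by simp
  also have "(\<lambda>y. v * exponential_density (1 / v) y) = (\<lambda>y. indicator {0..} y *\<^sub>R exp (- y / v))"
    using assms by (auto simp: exponential_density_def fun_eq_iff)
  finally show ?thesis
    unfolding set_integrable_def .
qed

lemma set_integrable_exp_decay_bounded:
  fixes f :: "real \<Rightarrow> real"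
  assumes v: "0 < (v :: real)" and [measurable]: "f \<in> borel_measurable borel"
    and f: "\<And>y. 0 \<le> y \<Longrightarrow> \<bar>f y\<bar> \<le> C"
  shows "set_integrable lborel {0..} (\<lambda>y. exp (- y / v) * f y)"
proof -
  have "set_integrable lborel {0..} (\<lambda>y. C * exp (- y / v))"
    using set_integrable_exp_decay[OF v] by simp
  then show ?thesis
    unfolding set_integrable_def
    by (rule Bochner_Integration.integrable_bound)
      (auto intro!: AE_I2 simp: abs_mult indicator_def f mult.commute[of C] intro: mult_left_mono order_trans[OF f])
qed

text \<open>Nodes are at least -1, so the root of the square is the distance itself. In this form
  \<open>quad_c\<close> is the path loss in \<open>disc_gain_cdf\<close>, evaluated at the squared
  distance of a node.\<close>

lemma quad_c_altdef:
  "0 < R \<Longrightarrow> quad_c R \<alpha> U u = 1 + sqrt ((R / 2 * (cheb_node U u + 1))\<^sup>2) powr \<alpha>"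
  using cos_plus_one_nonneg by (simp add: quad_c_def cheb_node_def abs_mult)

definition quad_gain_cdf :: "real \<Rightarrow> real \<Rightarrow> real \<Rightarrow> nat \<Rightarrow> real \<Rightarrow> real" where
  "quad_gain_cdf R \<eta> \<alpha> U w = (\<Sum>u=1..U. quad_b U u * (1 - exp (- w * quad_c R \<alpha> U u / \<eta>)))"

lemma measurable_quad_gain_cdf [measurable]: "quad_gain_cdf R \<eta> \<alpha> U \<in> borel_measurable borel"
  unfolding quad_gain_cdf_def by measurable

lemma quad_gain_cdf_tendsto:
  assumes "0 < R" "0 < \<eta>" "0 < \<alpha>"
  shows "(\<lambda>U. quad_gain_cdf R \<eta> \<alpha> U w) \<longlonglongrightarrow> disc_gain_cdf R \<eta> \<alpha> w"
  using disc_quadrature_tendsto[OF assms(1) continuous_on_disc_gain_integrand[OF assms(2,3)], of w] assms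
  by (simp add: quad_gain_cdf_def disc_gain_cdf_def quad_c_altdef)

text \<open>Measurability in the parameter of the integral is inherited from the quadrature sums,
  which are measurable and converge pointwise.\<close>

lemma measurable_disc_gain_cdf:
  assumes "0 < R" "0 < \<eta>" "0 < \<alpha>"
  shows "disc_gain_cdf R \<eta> \<alpha> \<in> borel_measurable borel"
  by (rule borel_measurable_LIMSEQ_real[OF quad_gain_cdf_tendsto[OF assms]]) simp

text \<open>For nonnegative \<open>w\<close> each factor \<open>1 - exp ...\<close> lies between 0
  and 1, so the sum is controlled by the total weight, uniformly in \<open>U\<close> and
  \<open>w\<close>.\<close>

lemma quad_gain_cdf_bounds:
  assumes "0 < \<eta>" "0 \<le> w"
  shows "0 \<le> quad_gain_cdf R \<eta> \<alpha> U w" "quad_gain_cdf R \<eta> \<alpha> U w \<le> pi"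
proof -
  have c: "0 \<le> w * quad_c R \<alpha> U u / \<eta>" for u
    using assms by (simp add: quad_c_def)
  show "0 \<le> quad_gain_cdf R \<eta> \<alpha> U w"
    unfolding quad_gain_cdf_def using c by (intro sum_nonneg mult_nonneg_nonneg quad_b_nonneg) simp
  have "quad_gain_cdf R \<eta> \<alpha> U w \<le> (\<Sum>u=1..U. quad_b U u)"
    unfolding quad_gain_cdf_def by (intro sum_mono mult_left_le quad_b_nonneg) simp
  then show "quad_gain_cdf R \<eta> \<alpha> U w \<le> pi"
    using sum_quad_b_le[of U] by linarith
qed

lemma set_integrable_quad_gain_power:
  assumes "0 < v" "0 < \<eta>" "0 \<le> \<theta>"
  shows "set_integrable lborel {0..} (\<lambda>y. exp (- y / v) * quad_gain_cdf R \<eta> \<alpha> U (\<theta> * y) ^ k)"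
proof (rule set_integrable_exp_decay_bounded[OF assms(1)])
  show "\<bar>quad_gain_cdf R \<eta> \<alpha> U (\<theta> * y) ^ k\<bar> \<le> pi ^ k" if "0 \<le> y" for y
    using quad_gain_cdf_bounds[OF assms(2), of "\<theta> * y"] assms(3) that
    by (simp add: power_abs power_mono)
qed measurable

text \<open>Dominated convergence with majorant \<open>pi ^ k * exp (- y / v)\<close> on the
  half-line yields both claims: integrability of the limit and convergence of the integrals.\<close>

lemma
  assumes v: "0 < v" and R: "0 < R" and \<eta>: "0 < \<eta>" and \<alpha>: "0 < \<alpha>" and \<theta>: "0 \<le> \<theta>"
  shows set_integrable_disc_gain_power:
      "set_integrable lborel {0..} (\<lambda>y. exp (- y / v) * disc_gain_cdf R \<eta> \<alpha> (\<theta> * y) ^ k)"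
    and quad_gain_power_integral_tendsto:
      "(\<lambda>U. LINT y:{0..}|lborel. exp (- y / v) * quad_gain_cdf R \<eta> \<alpha> U (\<theta> * y) ^ k) \<longlonglongrightarrow>
        (LINT y:{0..}|lborel. exp (- y / v) * disc_gain_cdf R \<eta> \<alpha> (\<theta> * y) ^ k)"
proof -
  have [measurable]: "disc_gain_cdf R \<eta> \<alpha> \<in> borel_measurable borel"
    by (rule measurable_disc_gain_cdf) fact+
  have bound: "integrable lborel (\<lambda>y. indicator {0..} y *\<^sub>R (pi ^ k * exp (- y / v)))"
    using set_integrable_exp_decay[OF v] unfolding set_integrable_def[symmetric] by simp
  have lim: "AE y in lborel. (\<lambda>U. indicator {0..} y *\<^sub>R (exp (- y / v) * quad_gain_cdf R \<eta> \<alpha> U (\<theta> * y) ^ k))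
      \<longlonglongrightarrow> indicator {0..} y *\<^sub>R (exp (- y / v) * disc_gain_cdf R \<eta> \<alpha> (\<theta> * y) ^ k)"
    by (intro AE_I2 tendsto_intros quad_gain_cdf_tendsto R \<eta> \<alpha>)
  have dom: "AE y in lborel. norm (indicator {0..} y *\<^sub>R (exp (- y / v) * quad_gain_cdf R \<eta> \<alpha> U (\<theta> * y) ^ k))
      \<le> indicator {0..} y *\<^sub>R (pi ^ k * exp (- y / v))" for U
    using quad_gain_cdf_bounds[OF \<eta>, of "\<theta> * _"] \<theta>
    by (intro AE_I2) (auto simp: indicator_def abs_mult power_abs power_mono mult.commute[of "pi ^ k"])
  show "set_integrable lborel {0..} (\<lambda>y. exp (- y / v) * disc_gain_cdf R \<eta> \<alpha> (\<theta> * y) ^ k)"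
    unfolding set_integrable_def
    by (rule integrable_dominated_convergence[OF _ _ bound lim dom]) measurable
  show "(\<lambda>U. LINT y:{0..}|lborel. exp (- y / v) * quad_gain_cdf R \<eta> \<alpha> U (\<theta> * y) ^ k) \<longlonglongrightarrow>
        (LINT y:{0..}|lborel. exp (- y / v) * disc_gain_cdf R \<eta> \<alpha> (\<theta> * y) ^ k)"
    unfolding set_lebesgue_integral_def
    by (rule integral_dominated_convergence[OF _ _ bound lim dom]) measurable
qed

section \<open>Outage events on a single subcarrier\<close>

lemma norm_vec_singleton:
  fixes v :: "'a::real_normed_vector ^ 'k::finite"
  assumes "UNIV = {k :: 'k}"
  shows "norm v = norm (v $ k)"
  by (simp add: norm_vec_def assms)

lemma norm_channel_singleton:
  fixes v :: "complex ^ 'k::finite"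
  assumes "UNIV = {k :: 'k}" and "0 < \<eta>"
  shows "(norm (channel \<eta> \<alpha> x v))\<^sup>2 = \<eta> * (cmod (v $ k))\<^sup>2 / (1 + cmod x powr \<alpha>)"
  using assms(2)
  by (simp add: norm_vec_singleton[OF assms(1)] channel_def norm_mult norm_divide power_mult_distrib power_divide)

text \<open>With one subcarrier the spreading entry is 1 and drops out, so both SINRs depend on the
  same channel gain.\<close>

lemma norm_diag_singleton:
  fixes v g :: "complex ^ 'k::finite"
  assumes "UNIV = {k :: 'k}" and "g $ k = 1"
  shows "norm (diag v *v g) = norm v"
  by (simp add: norm_vec_singleton[OF assms(1)] matrix_vector_mult_def diag_def assms)

text \<open>Clearing the positive denominator collects the gain with coefficient
  \<open>(a\<^sub>m - \<epsilon> * a\<^sub>n) * \<rho>\<close>. The power condition makes it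
  positive, so dividing by it keeps the direction of the inequality.\<close>

lemma sinr_cross_le_iff:
  assumes g: "norm (diag v *v g\<^sub>m) = norm v" "norm (diag v *v g\<^sub>n) = norm v"
    and pos: "0 < \<rho>" "0 \<le> a\<^sub>n" "\<epsilon> * a\<^sub>n < a\<^sub>m"
  shows "sinr_cross \<rho> a\<^sub>m a\<^sub>n v g\<^sub>m g\<^sub>n \<le> \<epsilon> \<longleftrightarrow> (norm v)\<^sup>2 \<le> \<epsilon> / (a\<^sub>m - \<epsilon> * a\<^sub>n) / \<rho>"
proof -
  have "0 < \<rho> * (norm v)\<^sup>2 * a\<^sub>n + 1"
    using pos by (intro add_nonneg_pos) auto
  then have "sinr_cross \<rho> a\<^sub>m a\<^sub>n v g\<^sub>m g\<^sub>n \<le> \<epsilon> \<longleftrightarrow> (norm v)\<^sup>2 * ((a\<^sub>m - \<epsilon> * a\<^sub>n) * \<rho>) \<le> \<epsilon>"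
    by (simp add: sinr_cross_def g divide_le_eq algebra_simps)
  also have "\<dots> \<longleftrightarrow> (norm v)\<^sup>2 \<le> \<epsilon> / ((a\<^sub>m - \<epsilon> * a\<^sub>n) * \<rho>)"
    using pos by (simp add: le_divide_eq)
  finally show ?thesis by simp
qed

lemma sinr_own_le_iff:
  assumes g: "norm (diag v *v g\<^sub>n) = norm v" and pos: "0 < \<rho>" "0 < a\<^sub>n"
  shows "sinr_own 1 \<rho> a\<^sub>n v g\<^sub>n v\<^sub>I \<le> \<epsilon> \<longleftrightarrow> (norm v)\<^sup>2 \<le> \<epsilon> / a\<^sub>n * ((norm v\<^sub>I)\<^sup>2 + 1 / \<rho>)"
proof -
  have "0 < \<rho> * (norm v\<^sub>I)\<^sup>2 + 1"
    using pos by (intro add_nonneg_pos) auto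
  then have "sinr_own 1 \<rho> a\<^sub>n v g\<^sub>n v\<^sub>I \<le> \<epsilon> \<longleftrightarrow> \<rho> * (norm v)\<^sup>2 * a\<^sub>n \<le> \<epsilon> * (\<rho> * (norm v\<^sub>I)\<^sup>2 + 1)"
    by (simp add: sinr_own_def g divide_le_eq)
  also have "\<dots> \<longleftrightarrow> (norm v)\<^sup>2 \<le> \<epsilon> / a\<^sub>n * ((norm v\<^sub>I)\<^sup>2 + 1 / \<rho>)"
    using pos by (simp add: field_simps)
  finally show ?thesis .
qed

text \<open>The indicators converge pointwise and are bounded by 1. If
  \<open>W \<le> \<theta> * Y\<close>, boundary included, the event holds for every positive \<rho>,
  as the threshold is at least \<open>\<theta> * Y\<close>; otherwise the threshold eventually drops
  below \<open>W\<close>.\<close>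

lemma (in prob_space) prob_le_max_tendsto:
  fixes W Y :: "'a \<Rightarrow> real" and \<theta> \<delta> :: real
  assumes [measurable]: "W \<in> borel_measurable M" "Y \<in> borel_measurable M"
    and nonneg: "\<And>\<omega>. 0 \<le> Y \<omega>" "0 \<le> \<theta>"
  shows "((\<lambda>\<rho>. prob {\<omega> \<in> space M. W \<omega> \<le> max (\<delta> / \<rho>) (\<theta> * (Y \<omega> + 1 / \<rho>))}) \<longlongrightarrow>
    prob {\<omega> \<in> space M. W \<omega> \<le> \<theta> * Y \<omega>}) at_top"
proof -
  define s :: "real \<Rightarrow> 'a \<Rightarrow> real"
    where "s \<rho> = indicator {\<omega> \<in> space M. W \<omega> \<le> max (\<delta> / \<rho>) (\<theta> * (Y \<omega> + 1 / \<rho>))}" for \<rho>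
  define f :: "'a \<Rightarrow> real" where "f = indicator {\<omega> \<in> space M. W \<omega> \<le> \<theta> * Y \<omega>}"
  have lim: "((\<lambda>\<rho>. s \<rho> \<omega>) \<longlongrightarrow> f \<omega>) at_top" if "\<omega> \<in> space M" for \<omega>
  proof (rule tendsto_eventually, cases "W \<omega> \<le> \<theta> * Y \<omega>")
    case True
    have "s \<rho> \<omega> = f \<omega>" if "0 < \<rho>" for \<rho>
    proof -
      have "\<theta> * Y \<omega> \<le> \<theta> * (Y \<omega> + 1 / \<rho>)"
        using that nonneg by (intro mult_left_mono) auto
      with True show ?thesis by (auto simp: s_def f_def indicator_def)
    qed
    then show "\<forall>\<^sub>F \<rho> in at_top. s \<rho> \<omega> = f \<omega>"
      by (rule eventually_mono[OF eventually_gt_at_top[of 0]])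
  next
    case False
    have "((\<lambda>\<rho>. max (\<delta> / \<rho>) (\<theta> * (Y \<omega> + 1 / \<rho>))) \<longlongrightarrow> max 0 (\<theta> * (Y \<omega> + 0))) at_top"
      by (intro tendsto_intros tendsto_divide_0[OF tendsto_const] filterlim_at_top_imp_at_infinity filterlim_ident)
    \<comment> \<open>Since \<open>\<theta> * Y \<omega>\<close> is nonnegative, the limit 0 of the
      first threshold does not raise the maximum.\<close>
    moreover have "max 0 (\<theta> * (Y \<omega> + 0)) < W \<omega>"
      using False mult_nonneg_nonneg[OF nonneg(2) nonneg(1)[of \<omega>]] by auto
    ultimately have "\<forall>\<^sub>F \<rho> in at_top. max (\<delta> / \<rho>) (\<theta> * (Y \<omega> + 1 / \<rho>)) < W \<omega>"
      by (rule order_tendstoD(2))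
    then show "\<forall>\<^sub>F \<rho> in at_top. s \<rho> \<omega> = f \<omega>"
      by eventually_elim (use False in \<open>auto simp: s_def f_def indicator_def\<close>)
  qed
  have "((\<lambda>\<rho>. integral\<^sup>L M (s \<rho>)) \<longlongrightarrow> integral\<^sup>L M f) at_top"
  proof (rule integral_dominated_convergence_at_top[where w = "\<lambda>_. 1"])
    show "f \<in> borel_measurable M" "\<And>\<rho>. s \<rho> \<in> borel_measurable M"
      unfolding s_def f_def by measurable
    show "AE \<omega> in M. ((\<lambda>\<rho>. s \<rho> \<omega>) \<longlongrightarrow> f \<omega>) at_top"
      using lim by (rule AE_I2)
    show "\<forall>\<^sub>F \<rho> in at_top. AE \<omega> in M. norm (s \<rho> \<omega>) \<le> 1"
      by (intro always_eventually allI AE_I2) (simp add: s_def indicator_def)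
  qed simp
  then show ?thesis unfolding s_def f_def by simp
qed

text \<open>As a function of the common value \<open>x\<close> of the individual distribution
  functions, this polynomial is the distribution function of the \<open>n\<close>-th smallest of
  \<open>N\<close> independent variables.\<close>

definition order_cdf :: "nat \<Rightarrow> nat \<Rightarrow> real \<Rightarrow> real" where
  "order_cdf N n x =
    order_coeff N n * (\<Sum>p=0..N - n. real ((N - n) choose p) * ((- 1) ^ p / real (n + p)) * x ^ (n + p))"

section \<open>Laws and independence of the gains in the single-subcarrier model\<close>

context downlink_noma
begin

definition gain :: "nat \<Rightarrow> 'w \<Rightarrow> real" where
  "gain i \<omega> = (norm (channel \<eta> \<alpha> (X i \<omega>) (h i \<omega>)))\<^sup>2"

definition ordered_gain :: "'w \<Rightarrow> real" where
  "ordered_gain \<omega> = (norm (ordered_channel M (\<lambda>i. channel \<eta> \<alpha> (X i \<omega>) (h i \<omega>)) n))\<^sup>2"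

lemma pairing': "1 \<le> n" "n \<le> M"
  using pairing by auto

lemma ordered_gain_eq: "ordered_gain \<omega> = gain (sort_key (\<lambda>i. gain i \<omega>) [1..<M+1] ! (n - 1)) \<omega>"
  by (simp add: ordered_gain_def ordered_channel_def gain_def)

lemma ordered_gain_le_iff: "ordered_gain \<omega> \<le> w \<longleftrightarrow> n \<le> card {i \<in> {1..M}. gain i \<omega> \<le> w}"
  unfolding ordered_gain_eq by (rule sort_key_nth_le_iff[OF pairing'])

lemma indep_location_fading:
  assumes "i \<in> {1..M}"
  shows "indep_var borel (X i) borel (\<lambda>\<omega>. h i \<omega> $ k)"
proof -
  have "indep_var borel ((\<lambda>x. x (Location i)) \<circ>
        (\<lambda>\<omega>. restrict (\<lambda>s. case s of Location i \<Rightarrow> X i \<omega> | Fading i k \<Rightarrow> h i \<omega> $ k | Residual k \<Rightarrow> hI \<omega> $ k) {Location i}))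
      borel ((\<lambda>x. x (Fading i k)) \<circ>
        (\<lambda>\<omega>. restrict (\<lambda>s. case s of Location i \<Rightarrow> X i \<omega> | Fading i k \<Rightarrow> h i \<omega> $ k | Residual k \<Rightarrow> hI \<omega> $ k) {Fading i k}))"
    using assms by (intro indep_var_compose[OF indep_var_restrict[OF independent]]) auto
  then show ?thesis by (simp add: o_def)
qed

context
  fixes k :: 'k
  assumes K: "UNIV = {k}"
begin

lemma gain_eq: "gain i \<omega> = \<eta> * (cmod (h i \<omega> $ k))\<^sup>2 / (1 + cmod (X i \<omega>) powr \<alpha>)"
  unfolding gain_def using params_pos by (intro norm_channel_singleton K)

text \<open>The gain of user \<open>i\<close> is a function of the sources \<open>Location i\<close>
  and \<open>Fading i k\<close>; these blocks are disjoint for different users, so independence of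
  the sources passes to the gains.\<close>

lemma indep_gain: "indep_vars (\<lambda>_. borel) gain {1..M}"
proof -
  let ?src = "\<lambda>s \<omega>. case s of Location i \<Rightarrow> X i \<omega> | Fading i k \<Rightarrow> h i \<omega> $ k | Residual k \<Rightarrow> hI \<omega> $ k"
  let ?K = "\<lambda>i. {Location i, Fading i k}"
  have "indep_vars (\<lambda>i. PiM (?K i) (\<lambda>_. borel)) (\<lambda>i \<omega>. restrict (\<lambda>s. ?src s \<omega>) (?K i)) {1..M}"
    by (rule indep_vars_restrict[OF independent]) (auto simp: disjoint_family_on_def)
  then have "indep_vars (\<lambda>_. borel) (\<lambda>i \<omega>. (\<lambda>x. \<eta> * (cmod (x (Fading i k)))\<^sup>2 / (1 + cmod (x (Location i)) powr \<alpha>))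
      (restrict (\<lambda>s. ?src s \<omega>) (?K i))) {1..M}"
    by (rule indep_vars_compose2) measurable
  then show ?thesis
    by (simp add: gain_eq[abs_def])
qed

lemma measurable_gain [measurable]: "i \<in> {1..M} \<Longrightarrow> gain i \<in> borel_measurable Pr"
  using indep_gain by (simp add: indep_vars_def)

lemma measurable_ordered_gain [measurable]: "ordered_gain \<in> borel_measurable Pr"
  unfolding ordered_gain_eq[abs_def] using measurable_gain by (rule measurable_order_statistic[OF pairing'])

lemma ordered_gain_cdf:
  assumes w: "0 \<le> w"
  shows "prob {\<omega> \<in> space Pr. ordered_gain \<omega> \<le> w} = order_cdf M n (disc_gain_cdf R\<^sub>D \<eta> \<alpha> w)"
proof -
  have "prob {\<omega> \<in> space Pr. gain i \<omega> \<le> w} = disc_gain_cdf R\<^sub>D \<eta> \<alpha> w" if "i \<in> {1..M}" for i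
    unfolding gain_eq using that w params_pos
    by (intro faded_gain_cdf locations fading indep_location_fading)
  then show ?thesis
    unfolding ordered_gain_le_iff order_cdf_def
    by (intro order_statistic_cdf indep_gain pairing')
qed

text \<open>The residual channel and the ordered gain are measurable functions of disjoint sets of
  sources. For the gain this means carrying out the sorting on the source values alone, which is the
  function \<open>g\<close> below.\<close>

lemma indep_residual_ordered_gain: "indep_var borel (\<lambda>\<omega>. (norm (hI \<omega>))\<^sup>2) borel ordered_gain"
proof -
  let ?src = "\<lambda>\<omega> s. case s of Location i \<Rightarrow> X i \<omega> | Fading i k \<Rightarrow> h i \<omega> $ k | Residual k \<Rightarrow> hI \<omega> $ k"
  let ?A = "{Residual k}" and ?B = "Location ` {1..M} \<union> {Fading i k | i k. i \<in> {1..M}} :: 'k source set"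
  define f :: "nat \<Rightarrow> ('k source \<Rightarrow> complex) \<Rightarrow> real"
    where "f i x = \<eta> * (cmod (x (Fading i k)))\<^sup>2 / (1 + cmod (x (Location i)) powr \<alpha>)" for i x
  have f: "f i \<in> borel_measurable (PiM ?B (\<lambda>_. borel))" if "i \<in> {1..M}" for i
  proof -
    have "Location i \<in> ?B" "Fading i k \<in> ?B" using that by auto
    then have [measurable]: "(\<lambda>x. x (Location i)) \<in> borel_measurable (PiM ?B (\<lambda>_. borel))"
      "(\<lambda>x. x (Fading i k)) \<in> borel_measurable (PiM ?B (\<lambda>_. borel))"
      by (auto intro: measurable_component_singleton)
    show ?thesis unfolding f_def by measurable
  qed
  define g where "g x = f (sort_key (\<lambda>i. f i x) [1..<M+1] ! (n - 1)) x" for x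
  have g: "g \<in> borel_measurable (PiM ?B (\<lambda>_. borel))"
    unfolding g_def using f by (rule measurable_order_statistic[OF pairing'])
  have "indep_var borel ((\<lambda>x. (cmod (x (Residual k)))\<^sup>2) \<circ> (\<lambda>\<omega>. restrict (?src \<omega>) ?A))
      borel (g \<circ> (\<lambda>\<omega>. restrict (?src \<omega>) ?B))"
    by (intro indep_var_compose[OF indep_var_restrict[OF independent]] g) auto
  moreover have "(\<lambda>x. (cmod (x (Residual k)))\<^sup>2) \<circ> (\<lambda>\<omega>. restrict (?src \<omega>) ?A) = (\<lambda>\<omega>. (norm (hI \<omega>))\<^sup>2)"
    by (simp add: o_def norm_vec_singleton[OF K])
  moreover have "g \<circ> (\<lambda>\<omega>. restrict (?src \<omega>) ?B) = ordered_gain"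
  proof
    fix \<omega>
    have eq: "f i (restrict (?src \<omega>) ?B) = gain i \<omega>" if "i \<in> {1..M}" for i
      using that by (auto simp: f_def gain_eq)
    \<comment> \<open>The two families of keys are only known to agree on \<open>{1..M}\<close>.
      Comparing sublevel sets suffices, since the counting form looks at no other index.\<close>
    have "g (restrict (?src \<omega>) ?B) \<le> w \<longleftrightarrow> n \<le> card {i \<in> {1..M}. f i (restrict (?src \<omega>) ?B) \<le> w}" for w
      unfolding g_def by (rule sort_key_nth_le_iff[OF pairing'])
    also have "{i \<in> {1..M}. f i (restrict (?src \<omega>) ?B) \<le> w} = {i \<in> {1..M}. gain i \<omega> \<le> w}" for w
      using eq by (intro Collect_cong conj_cong) auto
    finally have "g (restrict (?src \<omega>) ?B) \<le> w \<longleftrightarrow> ordered_gain \<omega> \<le> w" for w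
      unfolding ordered_gain_le_iff .
    then show "(g \<circ> (\<lambda>\<omega>. restrict (?src \<omega>) ?B)) \<omega> = ordered_gain \<omega>"
      by (auto intro: antisym)
  qed
  ultimately show ?thesis by simp
qed

text \<open>Given the residual power, which is exponential of mean \<open>\<Omega>\<^sub>I\<close>,
  the event is a sublevel event of the ordered gain. Its probability is a polynomial in
  \<open>disc_gain_cdf\<close>, integrated term by term.\<close>

lemma prob_ordered_gain_le_residual:
  assumes \<theta>: "0 \<le> \<theta>"
  shows "prob {\<omega> \<in> space Pr. ordered_gain \<omega> \<le> \<theta> * (norm (hI \<omega>))\<^sup>2} =
    order_coeff M n / \<Omega>\<^sub>I * (\<Sum>p=0..M - n. real ((M - n) choose p) * ((- 1) ^ p / real (n + p)) *
      (LINT y:{0..}|lborel. exp (- y / \<Omega>\<^sub>I) * disc_gain_cdf R\<^sub>D \<eta> \<alpha> (\<theta> * y) ^ (n + p)))"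
    (is "prob ?E = ?rhs")
proof -
  let ?F = "\<lambda>y. disc_gain_cdf R\<^sub>D \<eta> \<alpha> (\<theta> * y)"
  have [measurable]: "disc_gain_cdf R\<^sub>D \<eta> \<alpha> \<in> borel_measurable borel"
    using params_pos by (intro measurable_disc_gain_cdf)
  have [measurable]: "order_cdf M n \<in> borel_measurable borel"
    unfolding order_cdf_def by measurable
  have Y: "distributed Pr lborel (\<lambda>\<omega>. (norm (hI \<omega>))\<^sup>2) (\<lambda>y. ennreal (exponential_density (1 / \<Omega>\<^sub>I) y))"
    unfolding norm_vec_singleton[OF K] using params_pos by (intro complex_gaussian_norm_sq residual)
  define \<phi> where "\<phi> y = exponential_density (1 / \<Omega>\<^sub>I) y * order_cdf M n (?F y)" for y
  \<comment> \<open>The alternating signs hide nonnegativity; it is read off from the value being a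
    probability.\<close>
  have nonneg: "0 \<le> order_cdf M n (?F y)" if "0 \<le> y" for y
    using ordered_gain_cdf[of "\<theta> * y"] that \<theta> by (metis measure_nonneg mult_nonneg_nonneg)
  have "ennreal (prob ?E) = (\<integral>\<^sup>+\<omega>. ennreal (prob {\<omega>' \<in> space Pr. ordered_gain \<omega>' \<le> \<theta> * (norm (hI \<omega>))\<^sup>2}) \<partial>Pr)"
    using emeasure_indep_le[OF indep_residual_ordered_gain, of "\<lambda>y. \<theta> * y"]
    by (simp add: emeasure_eq_measure)
  also have "\<dots> = (\<integral>\<^sup>+\<omega>. ennreal (order_cdf M n (?F ((norm (hI \<omega>))\<^sup>2))) \<partial>Pr)"
    using \<theta> by (subst ordered_gain_cdf) auto
  also have "\<dots> = (\<integral>\<^sup>+y. ennreal (exponential_density (1 / \<Omega>\<^sub>I) y) * ennreal (order_cdf M n (?F y)) \<partial>lborel)"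
    by (rule distributed_nn_integral[OF Y, symmetric]) measurable
  \<comment> \<open>The density vanishes for negative \<open>y\<close>, so nonnegativity of the
    polynomial on the half-line is enough to merge the factors.\<close>
  also have "\<dots> = (\<integral>\<^sup>+y. ennreal (\<phi> y) \<partial>lborel)"
    using params_pos nonneg
    by (intro nn_integral_cong)
      (auto simp: \<phi>_def exponential_density_def ennreal_mult[symmetric] not_less)
  finally have "prob ?E = enn2real (\<integral>\<^sup>+y. ennreal (\<phi> y) \<partial>lborel)"
    by (metis enn2real_ennreal measure_nonneg)
  also have "\<dots> = integral\<^sup>L lborel \<phi>"
    using params_pos nonneg
    by (intro integral_eq_nn_integral[symmetric]) (auto simp: \<phi>_def exponential_density_def)
  \<comment> \<open>The rate of the exponential density supplies the factor
    \<open>1 / \<Omega>\<^sub>I\<close>, and its support supplies the indicator.\<close>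
  also have "\<phi> = (\<lambda>y. order_coeff M n / \<Omega>\<^sub>I * (\<Sum>p=0..M - n. real ((M - n) choose p) * ((- 1) ^ p / real (n + p)) *
      (indicator {0..} y *\<^sub>R (exp (- y / \<Omega>\<^sub>I) * ?F y ^ (n + p)))))"
    by (rule ext) (auto simp: \<phi>_def order_cdf_def exponential_density_def sum_distrib_left
        intro!: sum.cong split: split_indicator)
  also have "integral\<^sup>L lborel \<dots> = ?rhs"
    using set_integrable_disc_gain_power params_pos \<theta> unfolding set_integrable_def set_lebesgue_integral_def
    by (subst integral_mult_right_zero, subst Bochner_Integration.integral_sum) auto
  finally show ?thesis .
qed

end

end

text \<open>The approximation sign is read as convergence in \<open>U\<close> to the exact high-SNR
  limit of the COP. The integrability clause ensures that no integral in the formula takes the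
  default value 0.\<close>

theorem corollary6:
  fixes Pr :: "'w measure"
    and M m n :: nat
    and R\<^sub>D \<eta> \<alpha> \<Omega>\<^sub>I a\<^sub>m a\<^sub>n R\<^sub>m R\<^sub>n \<epsilon>\<^sub>m \<epsilon>\<^sub>n \<kappa> \<theta> :: real
    and X :: "nat \<Rightarrow> 'w \<Rightarrow> complex"
    and h :: "nat \<Rightarrow> 'w \<Rightarrow> complex ^ 'k::finite"
    and hI :: "'w \<Rightarrow> complex ^ 'k"
    and g :: "nat \<Rightarrow> complex ^ 'k"
    and h\<^sub>n :: "'w \<Rightarrow> complex ^ 'k"
  assumes model: "downlink_noma Pr M R\<^sub>D \<eta> \<alpha> \<Omega>\<^sub>I X h hI g m n a\<^sub>m a\<^sub>n R\<^sub>m R\<^sub>n"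
    and PD: "CARD('k) = 1"
    and ipSIC: "\<kappa> = 1"
    and eps_m: "\<epsilon>\<^sub>m = 2 powr R\<^sub>m - 1"
    and eps_n: "\<epsilon>\<^sub>n = 2 powr R\<^sub>n - 1"
    and feasible: "a\<^sub>m > \<epsilon>\<^sub>m * a\<^sub>n"
    and theta: "\<theta> = \<kappa> * \<epsilon>\<^sub>n / a\<^sub>n"
    and user_n: "h\<^sub>n = (\<lambda>\<omega>. ordered_channel M (\<lambda>i. channel \<eta> \<alpha> (X i \<omega>) (h i \<omega>)) n)"
  shows "(\<forall>U. \<forall>p\<in>{0..M - n}. set_integrable lborel {0..}
            (\<lambda>y. exp (- y / \<Omega>\<^sub>I) *
                 (\<Sum>u=1..U. quad_b U u * (1 - exp (- y * \<theta> * quad_c R\<^sub>D \<alpha> U u / \<eta>))) ^ (n + p)))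
    \<and> (\<exists>P_inf.
         ((\<lambda>\<rho>. cop_exf Pr
                 (\<lambda>\<omega>. sinr_cross \<rho> a\<^sub>m a\<^sub>n (h\<^sub>n \<omega>) (g m) (g n))
                 (\<lambda>\<omega>. sinr_own \<kappa> \<rho> a\<^sub>n (h\<^sub>n \<omega>) (g n) (hI \<omega>))
                 \<epsilon>\<^sub>m \<epsilon>\<^sub>n) \<longlongrightarrow> P_inf) at_top
       \<and> (\<lambda>U. order_coeff M n / \<Omega>\<^sub>I *
            (\<Sum>p=0..M - n. real ((M - n) choose p) * ((- 1) ^ p / real (n + p)) *
               (LINT y:{0..}|lborel. exp (- y / \<Omega>\<^sub>I) *
                 (\<Sum>u=1..U. quad_b U u * (1 - exp (- y * \<theta> * quad_c R\<^sub>D \<alpha> U u / \<eta>))) ^ (n + p))))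
           \<longlonglongrightarrow> P_inf)"
proof -
  interpret downlink_noma Pr M R\<^sub>D \<eta> \<alpha> \<Omega>\<^sub>I X h hI g m n a\<^sub>m a\<^sub>n R\<^sub>m R\<^sub>n
    by (rule model)
  obtain k :: 'k where K: "UNIV = {k}"
    using PD by (auto simp: card_1_singleton_iff)
  \<comment> \<open>Every column has an entry 1, and with a single subcarrier there is only one
    place for it.\<close>
  have one: "g \<phi> $ k = 1" if "\<phi> \<in> {1..M}" for \<phi>
    using spreading_mapped[OF that] K by (metis UNIV_I singletonD)
  have gm: "norm (diag v *v g m) = norm v" and gn: "norm (diag v *v g n) = norm v" for v
    using pairing by (auto intro!: norm_diag_singleton[OF K] one)
  have eps: "0 < \<epsilon>\<^sub>n"
    using rates by (simp add: eps_n)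
  have \<theta>: "0 \<le> \<theta>" "\<theta> = \<epsilon>\<^sub>n / a\<^sub>n"
    using eps power by (simp_all add: theta ipSIC)
  have W: "(norm (h\<^sub>n \<omega>))\<^sup>2 = ordered_gain \<omega>" for \<omega>
    by (simp add: user_n ordered_gain_def)
  have [measurable]: "ordered_gain \<in> borel_measurable Pr"
    by (rule measurable_ordered_gain[OF K])
  have [measurable]: "(\<lambda>\<omega>. (norm (hI \<omega>))\<^sup>2) \<in> borel_measurable Pr"
    using indep_residual_ordered_gain[OF K] by (simp add: indep_var_distribution_eq)
  have S: "(\<Sum>u=1..U. quad_b U u * (1 - exp (- y * \<theta> * quad_c R\<^sub>D \<alpha> U u / \<eta>))) =
      quad_gain_cdf R\<^sub>D \<eta> \<alpha> U (\<theta> * y)" for U y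
    by (simp add: quad_gain_cdf_def mult.commute[of y])
  define \<delta> where "\<delta> = \<epsilon>\<^sub>m / (a\<^sub>m - \<epsilon>\<^sub>m * a\<^sub>n)"
  define P where "P = prob {\<omega> \<in> space Pr. ordered_gain \<omega> \<le> \<theta> * (norm (hI \<omega>))\<^sup>2}"
  have cop: "cop_exf Pr
        (\<lambda>\<omega>. sinr_cross \<rho> a\<^sub>m a\<^sub>n (h\<^sub>n \<omega>) (g m) (g n))
        (\<lambda>\<omega>. sinr_own \<kappa> \<rho> a\<^sub>n (h\<^sub>n \<omega>) (g n) (hI \<omega>)) \<epsilon>\<^sub>m \<epsilon>\<^sub>n =
      prob {\<omega> \<in> space Pr. ordered_gain \<omega> \<le> max (\<delta> / \<rho>) (\<theta> * ((norm (hI \<omega>))\<^sup>2 + 1 / \<rho>))}"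
    if \<rho>: "0 < \<rho>" for \<rho>
  proof -
    have cross: "sinr_cross \<rho> a\<^sub>m a\<^sub>n (h\<^sub>n \<omega>) (g m) (g n) \<le> \<epsilon>\<^sub>m \<longleftrightarrow> ordered_gain \<omega> \<le> \<delta> / \<rho>" for \<omega>
      using sinr_cross_le_iff[OF gm gn \<rho> _ feasible] power by (simp add: W \<delta>_def)
    have own: "sinr_own \<kappa> \<rho> a\<^sub>n (h\<^sub>n \<omega>) (g n) (hI \<omega>) \<le> \<epsilon>\<^sub>n \<longleftrightarrow>
        ordered_gain \<omega> \<le> \<theta> * ((norm (hI \<omega>))\<^sup>2 + 1 / \<rho>)" for \<omega>
      using sinr_own_le_iff[OF gn \<rho>] power by (simp add: W \<theta>(2) ipSIC)
    show ?thesis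
      \<comment> \<open>The two outage events are disjoint; together they say that the gain is below
        at least one threshold, that is, below their maximum.\<close>
      unfolding cop_exf_def cross own not_le[symmetric]
      by (subst finite_measure_Union[symmetric]) (auto intro!: arg_cong[where f = prob] simp: le_max_iff_disj)
  qed
  have "((\<lambda>\<rho>. prob {\<omega> \<in> space Pr. ordered_gain \<omega> \<le> max (\<delta> / \<rho>) (\<theta> * ((norm (hI \<omega>))\<^sup>2 + 1 / \<rho>))})
      \<longlongrightarrow> P) at_top"
    unfolding P_def by (rule prob_le_max_tendsto) (simp_all add: \<theta>(1))
  \<comment> \<open>The identity \<open>cop\<close> is available for positive \<rho>, which suffices
    for a limit at infinity.\<close>
  then have "((\<lambda>\<rho>. cop_exf Pr
        (\<lambda>\<omega>. sinr_cross \<rho> a\<^sub>m a\<^sub>n (h\<^sub>n \<omega>) (g m) (g n))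
        (\<lambda>\<omega>. sinr_own \<kappa> \<rho> a\<^sub>n (h\<^sub>n \<omega>) (g n) (hI \<omega>)) \<epsilon>\<^sub>m \<epsilon>\<^sub>n) \<longlongrightarrow> P) at_top"
    by (rule Lim_transform_eventually)
      (use cop in \<open>auto intro!: eventually_mono[OF eventually_gt_at_top[of 0]]\<close>)
  moreover have "(\<lambda>U. order_coeff M n / \<Omega>\<^sub>I *
      (\<Sum>p=0..M - n. real ((M - n) choose p) * ((- 1) ^ p / real (n + p)) *
        (LINT y:{0..}|lborel. exp (- y / \<Omega>\<^sub>I) * quad_gain_cdf R\<^sub>D \<eta> \<alpha> U (\<theta> * y) ^ (n + p)))) \<longlonglongrightarrow> P"
    unfolding P_def prob_ordered_gain_le_residual[OF K \<theta>(1)]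
    by (intro tendsto_intros quad_gain_power_integral_tendsto params_pos \<theta>(1))
  moreover have "set_integrable lborel {0..}
      (\<lambda>y. exp (- y / \<Omega>\<^sub>I) * quad_gain_cdf R\<^sub>D \<eta> \<alpha> U (\<theta> * y) ^ (n + p))" for U p
    by (intro set_integrable_quad_gain_power params_pos \<theta>(1))
  ultimately show ?thesis
    unfolding S by blast
qed

end
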